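(* Let $k\ge 2$. In the game described in the context (starting from the empty board), Builder has a strategy such that, against every strategy of Painter, at least one of the following occurs: a red $P_3$ or a blue $P_3$ appears within the first $6k-5$ rounds; or after at most $6k-6$ rounds the board contains a bad green $P_{4k-3}$; or after at most $6k-5$ rounds the board contains a good green $P_{4k-3}$.
   Context: $P_m$ denotes the path on $m$ vertices. Game: Builder and Painter play on an infinite vertex set, initially with no edges; in each round Builder draws an edge between two nonadjacent vertices and Painter immediately colors it red, blue or green. A green path is a path all of whose edges are green. A green path is called good if at least one of its endpoints is incident to a red or blue edge, and bad otherwise. *)

theory Defs
  imports Main
begin

datatype color = Red | Blue | Green

text \<open>Edges are two-element sets of vertices. A history lists the drawn edges, each with the
  color it received, in chronological order; the board is the set of its entries.\<close>

type_synonym 'v board = "('v set \<times> color) set"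
type_synonym 'v history = "('v set \<times> color) list"

definition legal_move :: "'v set \<Rightarrow> 'v history \<Rightarrow> 'v set \<Rightarrow> bool" where
  "legal_move V h e \<longleftrightarrow>
     (\<exists>u\<in>V. \<exists>v\<in>V. u \<noteq> v \<and> e = {u, v}) \<and> e \<notin> fst ` set h"

inductive legal_history :: "'v set \<Rightarrow> 'v history \<Rightarrow> bool" for V where
  start: "legal_history V []"
| round: "legal_history V h \<Longrightarrow> legal_move V h e \<Longrightarrow> legal_history V (h @ [(e, c)])"

type_synonym 'v builder = "'v history \<Rightarrow> 'v set"
type_synonym 'v painter = "'v history \<Rightarrow> 'v set \<Rightarrow> color"

text \<open>Painter may color the drawn edge arbitrarily, so every function of type
  \<^typ>\<open>'v painter\<close> is a strategy; Builder must always draw a new edge.\<close>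

definition builder_strategy :: "'v set \<Rightarrow> 'v builder \<Rightarrow> bool" where
  "builder_strategy V \<sigma> \<longleftrightarrow> (\<forall>h. legal_history V h \<longrightarrow> legal_move V h (\<sigma> h))"

primrec play :: "'v builder \<Rightarrow> 'v painter \<Rightarrow> nat \<Rightarrow> 'v history" where
  "play \<sigma> \<pi> 0 = []"
| "play \<sigma> \<pi> (Suc t) =
     (let h = play \<sigma> \<pi> t; e = \<sigma> h in h @ [(e, \<pi> h e)])"

definition board_after :: "'v builder \<Rightarrow> 'v painter \<Rightarrow> nat \<Rightarrow> 'v board" where
  "board_after \<sigma> \<pi> t = set (play \<sigma> \<pi> t)"

text \<open>The list enumerates the vertices along a path on \<open>m\<close> vertices, all of whose edges have
  color \<open>c\<close>.\<close>

definition mono_path :: "'v board \<Rightarrow> color \<Rightarrow> nat \<Rightarrow> 'v list \<Rightarrow> bool" where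
  "mono_path B c m vs \<longleftrightarrow>
     length vs = m \<and> distinct vs \<and>
     (\<forall>i. Suc i < m \<longrightarrow> ({vs ! i, vs ! Suc i}, c) \<in> B)"

definition contains_path :: "'v board \<Rightarrow> color \<Rightarrow> nat \<Rightarrow> bool" where
  "contains_path B c m \<longleftrightarrow> (\<exists>vs. mono_path B c m vs)"

definition red_or_blue_incident :: "'v board \<Rightarrow> 'v \<Rightarrow> bool" where
  "red_or_blue_incident B v \<longleftrightarrow> (\<exists>e. v \<in> e \<and> ((e, Red) \<in> B \<or> (e, Blue) \<in> B))"

definition good :: "'v board \<Rightarrow> 'v list \<Rightarrow> bool" where
  "good B vs \<longleftrightarrow> red_or_blue_incident B (hd vs) \<or> red_or_blue_incident B (last vs)"

definition contains_good_green_path :: "'v board \<Rightarrow> nat \<Rightarrow> bool" where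
  "contains_good_green_path B m \<longleftrightarrow> (\<exists>vs. mono_path B Green m vs \<and> good B vs)"

definition contains_bad_green_path :: "'v board \<Rightarrow> nat \<Rightarrow> bool" where
  "contains_bad_green_path B m \<longleftrightarrow> (\<exists>vs. mono_path B Green m vs \<and> \<not> good B vs)"

end

theory Submission
  imports Defs
begin

text \<open>Lengthen a green path four edges at a time. A path with four more edges can be forced in six
  rounds from any green path, or in seven with one endpoint meeting a red or blue edge; if the
  given path is already good, five and six rounds suffice. Since red and blue have to
  remain matchings, a vertex meeting both colors can only receive green edges from then on, and
  the extra round paid for such a vertex is recovered later. Both extension strategies are finite
  decision trees, found by exhaustive search and verified here by a checker; they
  only use the endpoints of the given path and fresh vertices.\<close>

section \<open>Forcing\<close>

text \<open>The least fixed point describes game trees without infinite branches: Builder chooses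
  one edge, every color must be answered, and no strategy of Painter has to be mentioned.\<close>

inductive forces :: "'v set \<Rightarrow> ('v history \<Rightarrow> bool) \<Rightarrow> 'v history \<Rightarrow> bool" for V Q where
  reached: "Q h \<Longrightarrow> forces V Q h"
| draw: "legal_move V h e \<Longrightarrow> (\<And>c. forces V Q (h @ [(e, c)])) \<Longrightarrow> forces V Q h"

text \<open>Rounds only lengthen the history, so following the answer red down to a position with
  \<open>Q\<close> gives the bound.\<close>

lemma forces_length_le:
  assumes "forces V Q h" and "\<And>h. Q h \<Longrightarrow> length h \<le> N"
  shows "length h \<le> N"
  using assms(1)
proof induction
  case (reached h)
  then show ?case by (rule assms(2))
next
  case (draw h e)
  from draw.IH[of Red] show ?case by simp
qed

lemma forces_trans:
  assumes "forces V P h" and "legal_history V h"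
    and "\<And>h. legal_history V h \<Longrightarrow> P h \<Longrightarrow> forces V Q h"
  shows "forces V Q h"
  using assms(1,2)
proof induction
  case (reached h)
  then show ?case using assms(3) by blast
next
  case (draw h e)
  then show ?case by (meson forces.draw legal_history.round)
qed

section \<open>From forced goals to a strategy of Builder\<close>

lemma legal_move_exists:
  assumes "infinite V"
  shows "\<exists>e. legal_move V h e"
proof -
  obtain u where u: "u \<in> V"
    using assms by (metis finite.emptyI ex_in_conv)
  have "inj_on (\<lambda>v. {u, v}) (V - {u})"
    by (auto simp: inj_on_def doubleton_eq_iff)
  moreover have "infinite (V - {u})"
    using assms by simp
  ultimately have "infinite ((\<lambda>v. {u, v}) ` (V - {u}))"
    using finite_imageD by blast
  moreover have "finite (fst ` set h)"
    by simp
  ultimately obtain e where "e \<in> (\<lambda>v. {u, v}) ` (V - {u})" "e \<notin> fst ` set h"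
    by (meson finite_subset subsetI)
  then show ?thesis
    using u unfolding legal_move_def by blast
qed

lemma length_play [simp]: "length (play \<sigma> \<pi> t) = t"
  by (induction t) (simp_all add: Let_def)

text \<open>Builder keeps to edges after which \<open>Q\<close> is still forced. Such choices need
  not follow one derivation of \<open>forces\<close>, so termination comes from the length bound:
  forced positions have length at most \<open>N\<close>.\<close>

lemma forces_imp_strategy:
  assumes "infinite V" and "forces V Q []" and bound: "\<And>h. Q h \<Longrightarrow> length h \<le> N"
  shows "\<exists>\<sigma>. builder_strategy V \<sigma> \<and> (\<forall>\<pi>. \<exists>t. Q (play \<sigma> \<pi> t))"
proof -
  let ?win = "\<lambda>h e. legal_move V h e \<and> (\<forall>c. forces V Q (h @ [(e, c)]))"
  \<comment> \<open>\<open>builder_strategy\<close> asks for a legal move after every legal history,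
    hence the arbitrary legal edge when no edge keeps \<open>Q\<close> forced.\<close>
  define \<sigma> where "\<sigma> h = (if \<exists>e. ?win h e then SOME e. ?win h e else SOME e. legal_move V h e)" for h
  have win: "?win h (\<sigma> h)" if "\<exists>e. ?win h e" for h
    using someI_ex[OF that] that by (simp add: \<sigma>_def)
  have "legal_move V h (\<sigma> h)" for h
  proof (cases "\<exists>e. ?win h e")
    case False
    then show ?thesis
      using someI_ex[OF legal_move_exists[OF assms(1)]] unfolding \<sigma>_def if_not_P[OF False] by blast
  qed (use win in blast)
  moreover have "\<exists>t. Q (play \<sigma> \<pi> t)" for \<pi>
  proof (rule ccontr)
    assume never: "\<nexists>t. Q (play \<sigma> \<pi> t)"
    have "forces V Q (play \<sigma> \<pi> t)" for t
    proof (induction t)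
      case 0
      then show ?case using assms(2) by simp
    next
      case (Suc t)
      then have "\<exists>e. ?win (play \<sigma> \<pi> t) e"
        using never by (cases rule: forces.cases) blast+
      from win[OF this] show ?case
        by (simp add: Let_def)
    qed
    from forces_length_le[OF this bound] have "length (play \<sigma> \<pi> (Suc N)) \<le> N" .
    then show False
      unfolding length_play by simp
  qed
  ultimately show ?thesis
    unfolding builder_strategy_def by blast
qed

section \<open>Boards and paths\<close>

lemma legal_history_edgeD:
  "legal_history V h \<Longrightarrow> (e, c) \<in> set h \<Longrightarrow> \<exists>u\<in>V. \<exists>v\<in>V. u \<noteq> v \<and> e = {u, v}"
  by (induction rule: legal_history.induct) (auto simp: legal_move_def)

lemma mono_path_iff_successively:
  "mono_path B c m vs \<longleftrightarrow>
     length vs = m \<and> distinct vs \<and> successively (\<lambda>u v. ({u, v}, c) \<in> B) vs"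
  unfolding mono_path_def successively_conv_nth by auto

lemma mono_path_rev: "mono_path B c m vs \<Longrightarrow> mono_path B c m (rev vs)"
  by (simp add: mono_path_iff_successively insert_commute)

text \<open>With \<open>m \<ge> 2\<close> each end lies on a drawn edge; a path of a single vertex
  could lie outside \<open>V\<close>.\<close>

lemma mono_path_ends_in:
  assumes "legal_history V h" and "mono_path (set h) c m vs" and "m \<ge> 2"
  shows "hd vs \<in> V" and "last vs \<in> V"
proof -
  have edge: "({vs ! i, vs ! Suc i}, c) \<in> set h" if "Suc i < m" for i
    using assms(2) that by (simp add: mono_path_def)
  have len: "length vs = m"
    using assms(2) by (simp add: mono_path_def)
  have sub: "{vs ! i, vs ! Suc i} \<subseteq> V" if "Suc i < m" for i
    using legal_history_edgeD[OF assms(1) edge[OF that]] by (metis empty_subsetI insert_subset)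
  have "vs \<noteq> []"
    using len assms(3) by auto
  then have "hd vs = vs ! 0"
    by (rule hd_conv_nth)
  then show "hd vs \<in> V"
    using sub[of 0] assms(3) by simp
  have "length vs - 1 = Suc (m - 2)"
    using len assms(3) by simp
  with \<open>vs \<noteq> []\<close> have "last vs = vs ! Suc (m - 2)"
    using last_conv_nth by metis
  then show "last vs \<in> V"
    using sub[of "m - 2"] assms(3) by simp
qed

text \<open>The other end \<open>w\<close> of the old edge differs from \<open>b\<close>, since
  otherwise the new edge would already be drawn; so \<open>w\<close>, \<open>a\<close>,
  \<open>b\<close> is the path.\<close>

lemma contains_path_3:
  assumes "legal_history V h" and "{a, b} \<notin> fst ` set h" and "a \<noteq> b"
    and "(e, c) \<in> set h" and "a \<in> e"
  shows "contains_path (set (h @ [({a, b}, c)])) c 3"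
proof -
  obtain w where w: "e = {w, a}" "w \<noteq> a"
    using legal_history_edgeD[OF assms(1,4)] assms(5) by (auto simp: doubleton_eq_iff)
  have "w \<noteq> b"
  proof
    assume "w = b"
    then have "{a, b} = fst (e, c)"
      using w by (simp add: insert_commute)
    then show False
      using assms(2,4) by blast
  qed
  then have "mono_path (set (h @ [({a, b}, c)])) c 3 [w, a, b]"
    using w assms(3,4) by (simp add: mono_path_iff_successively)
  then show ?thesis
    unfolding contains_path_def by blast
qed

text \<open>Both round limits in one predicate: after fewer than \<open>N\<close> rounds any green
  path counts, after exactly \<open>N\<close> only a good one.\<close>

definition goal :: "nat \<Rightarrow> nat \<Rightarrow> 'v history \<Rightarrow> bool" where
  "goal N m h \<longleftrightarrow> length h \<le> N \<and>
     (contains_path (set h) Red 3 \<or> contains_path (set h) Blue 3 \<or>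
      contains_good_green_path (set h) m \<or> length h < N \<and> contains_path (set h) Green m)"

section \<open>Decision trees\<close>

text \<open>Trees refer to vertices by numbers: 0 is the last and 1 the first vertex of the given green
  path, all others are fresh. The subtrees of \<open>Draw\<close> are the answers to red, blue and green. The
  leaf \<open>Stop L R\<close> claims that \<open>L\<close>, appended at 1, and \<open>R\<close>, appended at 0, lengthen the path.\<close>

datatype tree = Stop "nat list" "nat list" | Draw nat nat tree tree tree

type_synonym position = "(nat \<times> nat \<times> color) list"

definition incident :: "(nat \<times> color) list \<Rightarrow> position \<Rightarrow> nat \<Rightarrow> color \<Rightarrow> bool" where
  "incident I E a c \<longleftrightarrow> (a, c) \<in> set I \<or> (\<exists>(x, y, d)\<in>set E. d = c \<and> (a = x \<or> a = y))"

definition green_edge :: "position \<Rightarrow> nat \<Rightarrow> nat \<Rightarrow> bool" where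
  "green_edge E a b \<longleftrightarrow> (a, b, Green) \<in> set E \<or> (b, a, Green) \<in> set E"

definition coloured :: "(nat \<times> color) list \<Rightarrow> position \<Rightarrow> nat \<Rightarrow> bool" where
  "coloured I E a \<longleftrightarrow> incident I E a Red \<or> incident I E a Blue"

text \<open>\<open>s\<close> tells whether the first vertex of the path may be used (it must then differ from the
  last one), \<open>I\<close> lists known incidences with earlier red and blue edges, \<open>r\<close> is the number of
  rounds left, the last of which may only be spent on obtaining a good path. A color is not
  considered if it would complete a monochromatic path on three vertices.\<close>

primrec certified :: "tree \<Rightarrow> bool \<Rightarrow> (nat \<times> color) list \<Rightarrow> nat \<Rightarrow> position \<Rightarrow> bool" where
  "certified (Stop L R) s I r E \<longleftrightarrow>
     length L + length R = 4 \<and> distinct (L @ R) \<and> (\<forall>i\<in>set (L @ R). 2 \<le> i) \<and>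
     successively (green_edge E) (0 # R) \<and> successively (green_edge E) (1 # L) \<and>
     (s \<or> L = []) \<and>
     (r \<noteq> 0 \<or> coloured I E (last (0 # R)) \<or> s \<and> coloured I E (last (1 # L)))"
| "certified (Draw a b t\<^sub>r t\<^sub>b t\<^sub>g) s I r E \<longleftrightarrow>
     r \<noteq> 0 \<and> a \<noteq> b \<and> (2 \<le> a \<or> 2 \<le> b) \<and> (\<forall>(x, y, d)\<in>set E. {x, y} \<noteq> {a, b}) \<and>
     (incident I E a Red \<or> incident I E b Red \<or> certified t\<^sub>r s I (r - 1) (E @ [(a, b, Red)])) \<and>
     (incident I E a Blue \<or> incident I E b Blue \<or> certified t\<^sub>b s I (r - 1) (E @ [(a, b, Blue)])) \<and>
     certified t\<^sub>g s I (r - 1) (E @ [(a, b, Green)])"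

definition place :: "(nat \<Rightarrow> 'v) \<Rightarrow> position \<Rightarrow> 'v history" where
  "place f E = map (\<lambda>(a, b, c). ({f a, f b}, c)) E"

lemma incident_imp_edge:
  assumes "incident I E a c" and "\<And>a c. (a, c) \<in> set I \<Longrightarrow> \<exists>e. (e, c) \<in> set h \<and> f a \<in> e"
  shows "\<exists>e. (e, c) \<in> set (h @ place f E) \<and> f a \<in> e"
proof (cases "(a, c) \<in> set I")
  case True
  then show ?thesis using assms(2) by auto
next
  case False
  then obtain x y where "(x, y, c) \<in> set E" "a = x \<or> a = y"
    using assms(1) unfolding incident_def by auto
  then have "({f x, f y}, c) \<in> set (place f E)" "f a \<in> {f x, f y}"
    by (force simp: place_def)+
  then show ?thesis by auto
qed

text \<open>Induction on the tree, \<open>r\<close> being the rounds still available within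
  \<open>N\<close>. Every tree edge has a fresh end and so is not in \<open>h\<close>; injectivity
  of \<open>f\<close> keeps distinct tree edges distinct on the board.\<close>

lemma certified_forces:
  fixes f :: "nat \<Rightarrow> 'v"
  assumes f: "inj f" "range f \<subseteq> V"
    and fresh: "\<And>i e c. 2 \<le> i \<Longrightarrow> (e, c) \<in> set h \<Longrightarrow> f i \<notin> e" "\<And>i. 2 \<le> i \<Longrightarrow> f i \<notin> set vs"
    and vs: "mono_path (set h) Green m vs" "vs \<noteq> []" "last vs = f 0" "s \<Longrightarrow> hd vs = f 1"
    and I: "\<And>a c. (a, c) \<in> set I \<Longrightarrow> \<exists>e. (e, c) \<in> set h \<and> f a \<in> e"
  shows "certified t s I r E \<Longrightarrow> legal_history V (h @ place f E) \<Longrightarrow>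
    length h + length E + r \<le> N \<Longrightarrow> forces V (goal N (m + 4)) (h @ place f E)"
proof (induction t arbitrary: r E)
  let ?h = "\<lambda>E. h @ place f E"
  case (Stop L R)
  have incidentD: "\<exists>e. (e, c) \<in> set (?h E) \<and> f a \<in> e" if "incident I E a c" for a c
    using that I by (rule incident_imp_edge)
  let ?adj = "\<lambda>u v. ({u, v}, Green) \<in> set (?h E)"
  \<comment> \<open>\<open>L\<close> is listed outward from the first vertex of \<open>vs\<close>,
    hence the reversal.\<close>
  let ?ws = "rev (map f L) @ vs @ map f R"
  have green: "?adj (f a) (f b)" if "green_edge E a b" for a b
    using that by (force simp: green_edge_def place_def insert_commute)
  have adj_commute: "(\<lambda>u v. ?adj v u) = ?adj"
    by (simp add: insert_commute)
  have chain: "successively ?adj (map f is)" if "successively (green_edge E) is" for "is"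
    unfolding successively_map using that by (rule successively_mono) (rule green)
  have R: "successively ?adj (f 0 # map f R)" and L: "successively ?adj (f 1 # map f L)"
    using chain[of "0 # R"] chain[of "1 # L"] Stop.prems(1) by simp_all
  have "successively ?adj vs"
    using vs(1) by (auto simp: mono_path_iff_successively elim: successively_mono)
  moreover have "successively ?adj (map f R)" "R \<noteq> [] \<longrightarrow> ?adj (f 0) (f (hd R))"
    using R by (cases R, simp_all)+
  moreover have "successively ?adj (rev (map f L))"
    unfolding successively_rev adj_commute using L by (cases L) simp_all
  moreover have "L \<noteq> [] \<longrightarrow> ?adj (f (hd L)) (f 1)"
    unfolding insert_commute[of "f (hd L)"] using L by (cases L) simp_all
  moreover have "L \<noteq> [] \<longrightarrow> hd vs = f 1"
    using Stop.prems(1) vs(4) by auto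
  ultimately have "successively ?adj ?ws"
    using vs(2,3) by (auto simp: successively_append_iff hd_map last_rev hd_append)
  moreover have "distinct ?ws"
  proof -
    have "distinct (map f (L @ R))"
      using Stop.prems(1) inj_on_subset[OF f(1) subset_UNIV] by (simp only: distinct_map) simp
    moreover have "f i \<notin> set vs" if "i \<in> set (L @ R)" for i
      using that Stop.prems(1) fresh(2) by simp
    moreover have "distinct vs"
      using vs(1) by (simp add: mono_path_def)
    ultimately show ?thesis
      by auto
  qed
  moreover have "length ?ws = m + 4"
    using Stop.prems(1) vs(1) by (simp add: mono_path_iff_successively)
  ultimately have path: "mono_path (set (?h E)) Green (m + 4) ?ws"
    by (simp add: mono_path_iff_successively)
  have len: "length (?h E) + r \<le> N"
    using Stop.prems(3) by (simp add: place_def)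
  have last: "last ?ws = f (last (0 # R))"
    using vs(2,3) by (cases R rule: rev_cases) auto
  have hd: "hd ?ws = f (last (1 # L))" if s
    using vs(2) vs(4)[OF that] by (cases L rule: rev_cases) auto
  have coloured: "red_or_blue_incident (set (?h E)) (f a)" if "coloured I E a" for a
    using that incidentD[of a] unfolding coloured_def red_or_blue_incident_def by blast
  have "good (set (?h E)) ?ws" if "r = 0"
    using Stop.prems(1) that coloured last hd unfolding good_def by (auto simp del: last.simps)
  \<comment> \<open>If a round is left, the history is shorter than \<open>N\<close> and any green
    path will do; otherwise the path is good.\<close>
  then have "goal N (m + 4) (?h E)"
    using path len unfolding goal_def contains_good_green_path_def contains_path_def
    by (cases "r = 0") auto
  then show ?case
    by (rule forces.reached)
next
  let ?h = "\<lambda>E. h @ place f E"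
  case (Draw a b t\<^sub>r t\<^sub>b t\<^sub>g)
  have incidentD: "\<exists>e. (e, c) \<in> set (?h E) \<and> f a \<in> e" if "incident I E a c" for a c
    using that I by (rule incident_imp_edge)
  have ab: "f a \<noteq> f b"
    using Draw.prems(1) injD[OF f(1)] by auto
  have new: "{f a, f b} \<notin> fst ` set (?h E)"
  proof
    assume "{f a, f b} \<in> fst ` set (?h E)"
    then consider c where "({f a, f b}, c) \<in> set h"
      | x y d where "(x, y, d) \<in> set E" "{f a, f b} = {f x, f y}"
      by (force simp: place_def)
    then show False
    proof cases
      case 1
      then show ?thesis
        using Draw.prems(1) fresh(1) by auto
    next
      case 2
      then have "{x, y} = {a, b}"
        by (auto simp: doubleton_eq_iff dest: injD[OF f(1)])
      then show ?thesis
        using 2(1) Draw.prems(1) by auto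
    qed
  qed
  have move: "legal_move V (?h E) {f a, f b}"
    using ab new f(2) unfolding legal_move_def by blast
  have snoc: "?h E @ [({f a, f b}, c)] = ?h (E @ [(a, b, c)])" for c
    by (simp add: place_def)
  have len: "length h + length (E @ [(a, b, c)]) + (r - 1) \<le> N" for c
    using Draw.prems(1,3) by auto
  have legal: "legal_history V (?h (E @ [(a, b, c)]))" for c
    using legal_history.round[OF Draw.prems(2) move, of c] unfolding snoc .
  have three: "contains_path (set (?h (E @ [(a, b, c)]))) c 3"
    if inc: "incident I E a c \<or> incident I E b c" for c
    using inc
  proof
    assume "incident I E a c"
    then obtain e where "(e, c) \<in> set (?h E)" "f a \<in> e"
      using incidentD by blast
    from contains_path_3[OF Draw.prems(2) new ab this] show ?thesis
      unfolding snoc .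
  next
    assume "incident I E b c"
    then obtain e where "(e, c) \<in> set (?h E)" "f b \<in> e"
      using incidentD by blast
    moreover have "{f b, f a} = {f a, f b}"
      by blast
    ultimately show ?thesis
      using contains_path_3[of V "?h E" "f b" "f a" e c] Draw.prems(2) new ab unfolding snoc[symmetric]
      by simp
  qed
  \<comment> \<open>A red or blue path on three vertices already wins, which justifies the branches
    that \<open>certified\<close> skips.\<close>
  have lost: "forces V (goal N (m + 4)) (?h (E @ [(a, b, c)]))"
    if "c \<noteq> Green" "incident I E a c \<or> incident I E b c" for c
  proof (rule forces.reached)
    have "c = Red \<or> c = Blue"
      using that(1) by (cases c) auto
    then show "goal N (m + 4) (?h (E @ [(a, b, c)]))"
      using three[OF that(2)] len[of c] unfolding goal_def by (auto simp: place_def)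
  qed
  have "forces V (goal N (m + 4)) (?h E @ [({f a, f b}, c)])" for c
    unfolding snoc
  proof (cases c)
    case Red
    have "certified t\<^sub>r s I (r - 1) (E @ [(a, b, Red)]) \<or> incident I E a Red \<or> incident I E b Red"
      using Draw.prems(1) by auto
    then show "forces V (goal N (m + 4)) (?h (E @ [(a, b, c)]))"
      unfolding Red using Draw.IH(1)[OF _ legal len] lost[OF color.distinct(3)] by blast
  next
    case Blue
    have "certified t\<^sub>b s I (r - 1) (E @ [(a, b, Blue)]) \<or> incident I E a Blue \<or> incident I E b Blue"
      using Draw.prems(1) by auto
    then show "forces V (goal N (m + 4)) (?h (E @ [(a, b, c)]))"
      unfolding Blue using Draw.IH(2)[OF _ legal len] lost[OF color.distinct(5)] by blast
  next
    case Green
    have "certified t\<^sub>g s I (r - 1) (E @ [(a, b, Green)])"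
      using Draw.prems(1) by auto
    from Draw.IH(3)[OF this legal len] show "forces V (goal N (m + 4)) (?h (E @ [(a, b, c)]))"
      unfolding Green .
  qed
  with move show ?case
    by (rule forces.draw)
qed

section \<open>The extension strategies\<close>

text \<open>Mirror image of a tree under the exchange of red and blue, so that symmetric branches
  are written only once.\<close>

primrec swap :: "tree \<Rightarrow> tree" where
  "swap (Stop L R) = Stop L R"
| "swap (Draw a b t\<^sub>r t\<^sub>b t\<^sub>g) = Draw a b (swap t\<^sub>b) (swap t\<^sub>r) (swap t\<^sub>g)"

text \<open>Never certified, as it appends no vertices: it can only stand under a color already
  present at an end of the edge.\<close>

abbreviation "void \<equiv> Stop [] []"

text \<open>For edges whose ends together meet both red and blue, so that green is the only answer
  to consider.\<close>

abbreviation "Force a b t \<equiv> Draw a b void void t"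

abbreviation "Split a b t t\<^sub>g \<equiv> Draw a b t (swap t) t\<^sub>g"

text \<open>Only vertex 0 and fresh vertices occur, so the tree also extends a path of one
  vertex.\<close>

definition extend_any :: tree where
  "extend_any =
    Split 2 3
      (Draw 2 4 void
        (Force 2 5 (Force 0 2 (Force 3 4 (Draw 3 6 void
          (Force 3 5 (Stop [] [2, 5, 3, 4]))
          (Force 2 6 (Stop [] [2, 6, 3, 4]))))))
        (Draw 0 3 void
          (Force 3 5 (Force 0 2 (Force 3 4 (Stop [] [2, 4, 3, 5]))))
          (Draw 2 5 void
            (Force 2 6 (Draw 3 4 void
              (Force 3 6 (Stop [] [3, 6, 2, 4]))
              (Stop [] [3, 4, 2, 6])))
            (Draw 3 4 void
              (Force 3 5 (Stop [] [3, 5, 2, 4]))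
              (Stop [] [3, 4, 2, 5])))))
      (Split 0 4
        (Draw 4 5 void
          (Force 4 6 (Force 2 4 (Draw 0 3 void
            (Force 0 6 (Stop [] [6, 4, 2, 3]))
            (Stop [] [3, 2, 4, 6]))))
          (Draw 2 4 void
            (Force 0 2 (Force 3 4 (Stop [] [2, 3, 4, 5])))
            (Draw 0 3 void
              (Force 0 5 (Stop [] [5, 4, 2, 3]))
              (Stop [] [3, 2, 4, 5]))))
        (Split 2 4
          (Draw 2 5 void
            (Force 2 6 (Draw 3 4 void
              (Force 4 6 (Stop [] [4, 6, 2, 3]))
              (Stop [] [4, 3, 2, 6])))
            (Draw 3 4 void
              (Force 4 5 (Stop [] [4, 5, 2, 3]))
              (Stop [] [4, 3, 2, 5])))
          (Split 3 5
            (Draw 3 6 void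
              (Force 3 7 (Stop [] [4, 2, 3, 7]))
              (Stop [] [4, 2, 3, 6]))
            (Stop [] [4, 2, 3, 5]))))"

text \<open>Written for the case that vertex 0 meets a red edge.\<close>

definition extend_good :: tree where
  "extend_good =
    Draw 2 3
      (Draw 2 4 void
        (Force 2 5 (Force 0 4 (Force 1 2 (Force 3 4 (Stop [2, 5] [4, 3])))))
        (Draw 0 5 void
          (Force 0 4 (Force 2 5 (Force 3 5 (Stop [] [4, 2, 5, 3]))))
          (Draw 1 2 void
            (Force 1 3 (Force 2 5 (Stop [3] [5, 2, 4])))
            (Draw 3 4 void
              (Force 3 5 (Stop [2, 4] [5, 3]))
              (Stop [2, 4, 3] [5])))))
      (Force 0 2 (Draw 3 4
        (Force 3 5 (Force 1 3 (Force 2 4 (Stop [3, 5] [2, 4]))))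
        void
        (Draw 2 5
          (Force 2 4 (Force 3 5 (Stop [] [2, 4, 3, 5])))
          void
          (Draw 1 3
            (Force 3 5 (Stop [] [2, 5, 3, 4]))
            void
            (Stop [3, 4] [2, 5])))))
      (Draw 0 4 void
        (Force 0 5 (Draw 1 4
          (Force 2 4 (Force 4 5 (Stop [] [5, 4, 2, 3])))
          void
          (Draw 2 4
            (Force 3 4 (Stop [4, 3, 2] [5]))
            void
            (Stop [4, 2, 3] [5]))))
        (Split 1 5
          (Draw 1 2 void
            (Force 1 3 (Force 2 5 (Stop [3, 2, 5] [4])))
            (Draw 3 5 void
              (Force 4 5 (Stop [2, 3] [4, 5]))
              (Stop [2, 3, 5] [4])))
          (Split 2 6
            (Draw 2 4 void
              (Force 2 5 (Stop [5, 2, 3] [4]))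
              (Stop [5] [4, 2, 3]))
            (Draw 0 3 void
              (Force 0 6 (Stop [5] [6, 2, 3]))
              (Stop [5] [3, 2, 6])))))"

lemma certified_extend_any: "certified extend_any False [] 7 []"
  by code_simp

lemma certified_extend_good:
  "certified extend_good True [(0, Red)] 6 []"
  "certified (swap extend_good) True [(0, Blue)] 6 []"
  by code_simp+

section \<open>Placing the trees on a board and iterating the extension\<close>

lemma fresh_placement:
  assumes "infinite V" and "finite F" and "u \<in> V" and "x \<in> V" and "u \<noteq> x"
  shows "\<exists>f :: nat \<Rightarrow> 'v. inj f \<and> range f \<subseteq> V \<and> f 0 = u \<and> f 1 = x \<and> (\<forall>i\<ge>2. f i \<notin> F)"
proof -
  have "infinite (V - (F \<union> {u, x}))"
    using assms(1,2) by simp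
  then obtain g :: "nat \<Rightarrow> 'v" where g: "inj g" "range g \<subseteq> V - (F \<union> {u, x})"
    using infinite_countable_subset by blast
  define f where "f i = (if i = 0 then u else if i = 1 then x else g i)" for i
  have "g i \<in> V" "g i \<notin> F" "g i \<noteq> u" "g i \<noteq> x" for i
    using g(2) by auto
  then have "inj f"
    using assms(5) injD[OF g(1)] unfolding f_def inj_def by (auto split: if_splits)
  moreover have "range f \<subseteq> V"
    using g(2) assms(3,4) unfolding f_def by auto
  ultimately show ?thesis
    using g(2) by (intro exI[of _ f]) (auto simp: f_def)
qed

lemma extension_forces:
  assumes "infinite V" and "legal_history V h" and path: "mono_path (set h) Green m vs" "vs \<noteq> []"
    and ends: "last vs \<in> V" "s \<Longrightarrow> hd vs \<in> V" "s \<Longrightarrow> m \<ge> 2"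
    and inc: "\<And>a c. (a, c) \<in> set I \<Longrightarrow> a = 0 \<and> (\<exists>e. (e, c) \<in> set h \<and> last vs \<in> e)"
    and t: "certified t s I r []" and "length h + r \<le> N"
  shows "forces V (goal N (m + 4)) h"
proof -
  \<comment> \<open>Number 1 needs an image too: the first vertex if \<open>s\<close> holds, where
    \<open>m \<ge> 2\<close> separates it from the last one, and otherwise any other vertex of
    \<open>V\<close>.\<close>
  have "\<exists>x\<in>V. last vs \<noteq> x \<and> (s \<longrightarrow> x = hd vs)"
  proof (cases s)
    case True
    have "last vs \<noteq> hd vs"
      using path ends(3)[OF True]
      by (cases vs) (auto simp: mono_path_def)
    then show ?thesis
      using ends(2) True by blast
  next
    case False
    then show ?thesis
      using assms(1) by (metis finite.emptyI finite.insertI finite_subset insertCI subsetI)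
  qed
  then obtain x where x: "x \<in> V" "last vs \<noteq> x" "s \<Longrightarrow> x = hd vs"
    by blast
  have "finite e" if "e \<in> fst ` set h" for e
    using that legal_history_edgeD[OF assms(2)] by force
  then have "finite (\<Union> (fst ` set h) \<union> set vs)"
    by blast
  from fresh_placement[OF assms(1) this ends(1) x(1,2)]
  obtain f :: "nat \<Rightarrow> 'a" where f: "inj f" "range f \<subseteq> V" "f 0 = last vs" "f 1 = x"
    "\<And>i. i \<ge> 2 \<Longrightarrow> f i \<notin> \<Union> (fst ` set h) \<union> set vs"
    by blast
  have "forces V (goal N (m + 4)) (h @ place f [])"
  proof (rule certified_forces[OF f(1,2) _ _ path _ _ _ t])
    show "f i \<notin> e" if "2 \<le> i" "(e, c) \<in> set h" for i e c
      using f(5)[OF that(1)] that(2) by force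
    show "\<exists>e. (e, c) \<in> set h \<and> f a \<in> e" if "(a, c) \<in> set I" for a c
      using inc[OF that] f(3) by metis
  qed (use f x assms(2,10) in \<open>auto simp: place_def\<close>)
  then show ?thesis
    by (simp add: place_def)
qed

text \<open>A good path found within \<open>N\<close> rounds leaves six rounds up to
  \<open>N + 6\<close>, the budget of \<open>extend_good\<close>. Without goodness the path was
  found in fewer than \<open>N\<close> rounds, which leaves the seven of
  \<open>extend_any\<close>.\<close>

lemma goal_step:
  assumes "infinite V" and "legal_history V h" and "m \<ge> 2" and "goal N m h"
  shows "forces V (goal (N + 6) (m + 4)) h"
proof -
  have len: "length h \<le> N"
    using assms(4) by (simp add: goal_def)
  consider (three) "contains_path (set h) Red 3 \<or> contains_path (set h) Blue 3"
    | (good) vs where "mono_path (set h) Green m vs" "red_or_blue_incident (set h) (last vs)"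
    | (any) vs where "mono_path (set h) Green m vs" "length h < N"
  proof -
    \<comment> \<open>If only the first vertex meets red or blue, reversing the path moves it to the
      end numbered 0.\<close>
    have "\<exists>vs. mono_path (set h) Green m vs \<and> red_or_blue_incident (set h) (last vs)"
      if "mono_path (set h) Green m vs" "good (set h) vs" for vs
      using that mono_path_rev[OF that(1)] unfolding good_def by (metis last_rev)
    then show thesis
      using assms(4) that unfolding goal_def contains_good_green_path_def contains_path_def[of _ Green]
      by blast
  qed
  then show ?thesis
  proof cases
    case three
    then have "goal (N + 6) (m + 4) h"
      using len by (auto simp: goal_def)
    then show ?thesis
      by (rule forces.reached)
  next
    case good
    have "vs \<noteq> []"
      using good(1) assms(3) by (auto simp: mono_path_def)
    note step = extension_forces[OF assms(1,2) good(1) this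
        mono_path_ends_in(2,1)[OF assms(2) good(1) assms(3)] assms(3)]
    from good(2) obtain e where "last vs \<in> e" "(e, Red) \<in> set h \<or> (e, Blue) \<in> set h"
      unfolding red_or_blue_incident_def by blast
    then show ?thesis
      using step[OF _ certified_extend_good(1), of "N + 6"]
        step[OF _ certified_extend_good(2), of "N + 6"] len by auto
  next
    case any
    have "vs \<noteq> []"
      using any(1) assms(3) by (auto simp: mono_path_def)
    then show ?thesis
      using extension_forces[OF assms(1,2) any(1) _ _ _ _ _ certified_extend_any]
        mono_path_ends_in(2)[OF assms(2) any(1) assms(3)] any(2) by auto
  qed
qed

lemma forces_goal:
  assumes "infinite V"
  shows "forces V (goal (6 * n + 7) (4 * n + 5)) []"
proof (induction n)
  case 0
  obtain v where "v \<in> V"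
    using assms by (metis finite.emptyI ex_in_conv)
  \<comment> \<open>The case \<open>k = 2\<close>: on the empty board a single vertex is a green
    path, and \<open>extend_any\<close> makes it one on five vertices within seven rounds.\<close>
  then show ?case
    using extension_forces[OF assms legal_history.start, of 1 "[v]", OF _ _ _ _ _ _ certified_extend_any]
    by (simp add: mono_path_def)
next
  case (Suc n)
  have "forces V (goal (6 * n + 7 + 6) (4 * n + 5 + 4)) []"
  proof (rule forces_trans[OF Suc legal_history.start])
    show "forces V (goal (6 * n + 7 + 6) (4 * n + 5 + 4)) h"
      if "legal_history V h" "goal (6 * n + 7) (4 * n + 5) h" for h
      using goal_step[OF assms that(1) _ that(2)] by simp
  qed
  then show ?case
    by (simp add: algebra_simps)
qed

theorem theorem3p7:
  fixes V :: "'v set" and k :: nat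
  assumes "infinite V" and "k \<ge> 2"
  shows "\<exists>\<sigma>. builder_strategy V \<sigma> \<and>
    (\<forall>\<pi>.
      (\<exists>t \<le> 6 * k - 5. contains_path (board_after \<sigma> \<pi> t) Red 3 \<or>
                         contains_path (board_after \<sigma> \<pi> t) Blue 3) \<or>
      (\<exists>t \<le> 6 * k - 6. contains_bad_green_path (board_after \<sigma> \<pi> t) (4 * k - 3)) \<or>
      (\<exists>t \<le> 6 * k - 5. contains_good_green_path (board_after \<sigma> \<pi> t) (4 * k - 3)))"
proof -
  obtain n where k: "k = n + 2"
    using assms(2) le_Suc_ex by (metis add.commute)
  have "6 * k - 5 = 6 * n + 7" "4 * k - 3 = 4 * n + 5"
    using k by simp_all
  then have "forces V (goal (6 * k - 5) (4 * k - 3)) []"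
    using forces_goal[OF assms(1), of n] by simp
  from forces_imp_strategy[OF assms(1) this, of "6 * k - 5"]
  obtain \<sigma> where \<sigma>: "builder_strategy V \<sigma>"
    and goal: "\<And>\<pi>. \<exists>t. goal (6 * k - 5) (4 * k - 3) (play \<sigma> \<pi> t)"
    by (auto simp: goal_def)
  have "(\<exists>t \<le> 6 * k - 5. contains_path (board_after \<sigma> \<pi> t) Red 3 \<or>
                         contains_path (board_after \<sigma> \<pi> t) Blue 3) \<or>
      (\<exists>t \<le> 6 * k - 6. contains_bad_green_path (board_after \<sigma> \<pi> t) (4 * k - 3)) \<or>
      (\<exists>t \<le> 6 * k - 5. contains_good_green_path (board_after \<sigma> \<pi> t) (4 * k - 3))" for \<pi>
  proof -
    obtain t where t: "goal (6 * k - 5) (4 * k - 3) (play \<sigma> \<pi> t)"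
      using goal by blast
    \<comment> \<open>A green path obtained before the last round may turn out good or bad; the
      smaller limit covers both.\<close>
    have "t \<le> 6 * k - 6" if "t < 6 * k - 5"
      using that by simp
    with t show ?thesis
      unfolding goal_def board_after_def contains_bad_green_path_def contains_good_green_path_def
        contains_path_def[of _ Green] length_play
      by blast
  qed
  with \<sigma> show ?thesis
    by blast
qed

end
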